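(* Let $1<p\le\infty$ and let $A,B:L_p(\mathbb{R},\mu)\to L_p(\mathbb{R},\mu)$ be the operators defined, for almost every $t$, by $$(Ax)(t)=\int_1^2I_{[\alpha,\infty[}(t)\Big(\frac{\gamma_{A,2}}{t}-\frac{2\gamma_{A,2}\ln2}{ts}\Big)x(s)\,d\mu_s,\qquad (Bx)(t)=\int_1^2I_{[\alpha,\infty[}(t)\frac{\gamma_{B,2}}{t}x(s)\,d\mu_s,$$ where $\gamma_{A,2},\gamma_{B,2}\in\mathbb{R}$ and $0<\alpha\le1$. Let $\{\gamma_n\}$ be a sequence of real numbers and let $A_n:L_p(\mathbb{R},\mu)\to L_p(\mathbb{R},\mu)$ be defined, for almost every $t$, by $$(A_nx)(t)=\int_1^2I_{[\alpha,\infty[}(t)\Big(\frac{\gamma_n}{t}-\frac{2\gamma_n\ln2}{ts}\Big)x(s)\,d\mu_s.$$ Let $\Lambda=\{(\gamma_{A,2},\gamma_{B,2},\alpha)\in\mathbb{R}^3:\ 0<\alpha\le1\}$ and let $\mathrm{cl}(\Lambda)$ be its closure in $\mathbb{R}^3$. Then: 1. For every $\delta\in\mathbb{R}$: $AB=\delta BA^2=0$, and $A_nB=\delta BA_n^2$ for each positive integer $n$. Moreover, for all $x\in L_p(\mathbb{R},\mu)$ and almost every $t$, $$(AB-BA)x(t)=-(BAx)(t)=-\gamma_{A,2}\gamma_{B,2}\ln2\int_1^2I_{[\alpha,\infty[}(t)\frac1t\Big(1-\frac{2\ln2}{s}\Big)x(s)\,d\mu_s.$$ 2. If $\gamma_n\to0$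 as $n\to\infty$, then $A_n\to0$ in norm and so $A_nB-BA_n\to0$ in norm. 3. Let $\lambda_0\in\mathrm{cl}(\Lambda)$. If either $1<p<\infty$ and $\gamma_{A,2}\gamma_{B,2}\alpha^{\frac{1-p}{p}}\to0$, or $p=\infty$ and $\gamma_{A,2}\gamma_{B,2}\frac1\alpha\to0$, when $(\gamma_{A,2},\gamma_{B,2},\alpha)\to\lambda_0$ within $\Lambda$, then for all $x\in L_p(\mathbb{R},\mu)$ it holds that $\|(AB-BA)x\|_{L_p}\to0$ (along the same limit of parameters, $A$ and $B$ being the operators with these parameters).
   Context: $\mu$ is Lebesgue measure on $\mathbb{R}$; $L_p(\mathbb{R},\mu)$ is the real Lebesgue space; the index in $d\mu_s$ indicates the variable of integration; $I_E$ is the indicator function of the set $E$ and $[\alpha,\infty[$ is the half-open interval $\{t\in\mathbb{R}: t\ge\alpha\}$; convergence in norm means convergence in the operator norm on $L_p(\mathbb{R},\mu)$. *)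

theory Defs
  imports "HOL-Analysis.Analysis" "HOL-Probability.Essential_Supremum"
begin

text \<open>
  Since types cannot depend on the exponent, elements of the spaces \<open>L_p\<close> are members of a
  single type of Lebesgue measurable functions modulo equality almost everywhere; \<open>Lp p\<close> is
  then a subset of that type.
\<close>

quotient_type ae_fun = "real \<Rightarrow> real" / partial:
  "\<lambda>f g. f \<in> borel_measurable lebesgue \<and> g \<in> borel_measurable lebesgue \<and>
         (AE t in lebesgue. f t = g t)"
  morphisms rep_ae_fun abs_ae_fun
proof (rule part_equivpI)
  show "\<exists>f::real \<Rightarrow> real. f \<in> borel_measurable lebesgue \<and> f \<in> borel_measurable lebesgue \<and>
         (AE t in lebesgue. f t = f t)"
    by (rule exI[of _ "\<lambda>_. 0"]) auto
qed (auto intro!: sympI transpI elim: AE_mp)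

lemma borel_imp_lebesgue_measurable:
  "f \<in> borel_measurable borel \<Longrightarrow> f \<in> borel_measurable lebesgue"
  by (rule measurable_completion) simp

text \<open>\<open>rep_ae_fun\<close> picks an unspecified representative, so its values are only meaningful
  almost everywhere.\<close>

instantiation ae_fun :: real_vector
begin

lift_definition zero_ae_fun :: ae_fun is "\<lambda>t. 0"
  by simp

lift_definition plus_ae_fun :: "ae_fun \<Rightarrow> ae_fun \<Rightarrow> ae_fun" is "\<lambda>f g t. f t + g t"
  by auto

lift_definition minus_ae_fun :: "ae_fun \<Rightarrow> ae_fun \<Rightarrow> ae_fun" is "\<lambda>f g t. f t - g t"
  by auto

lift_definition uminus_ae_fun :: "ae_fun \<Rightarrow> ae_fun" is "\<lambda>f t. - f t"
  by auto

lift_definition scaleR_ae_fun :: "real \<Rightarrow> ae_fun \<Rightarrow> ae_fun" is "\<lambda>c f t. c * f t"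
  by auto

instance
  by (standard; transfer; auto simp: algebra_simps)

end

lift_definition Lp_norm :: "ennreal \<Rightarrow> ae_fun \<Rightarrow> ennreal" is
  "\<lambda>p f. if p = \<infinity> then esssup lebesgue (\<lambda>t. ennreal \<bar>f t\<bar>)
         else let I = (\<integral>\<^sup>+ t. ennreal (\<bar>f t\<bar> powr enn2real p) \<partial>lebesgue)
              in if I = \<infinity> then \<infinity> else ennreal (enn2real I powr (1 / enn2real p))"
  subgoal for p f g
    apply (subgoal_tac "(\<integral>\<^sup>+ t. ennreal (\<bar>f t\<bar> powr enn2real p) \<partial>lebesgue)
        = (\<integral>\<^sup>+ t. ennreal (\<bar>g t\<bar> powr enn2real p) \<partial>lebesgue)")
     apply (subgoal_tac "esssup lebesgue (\<lambda>t. ennreal \<bar>f t\<bar>) = esssup lebesgue (\<lambda>t. ennreal \<bar>g t\<bar>)")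
      apply simp
     apply (rule esssup_AE_cong; auto)
    apply (rule nn_integral_cong_AE; auto)
    done
  done

definition Lp :: "ennreal \<Rightarrow> ae_fun set" where
  "Lp p = {x. Lp_norm p x < \<infinity>}"

definition Lp_opnorm :: "ennreal \<Rightarrow> (ae_fun \<Rightarrow> ae_fun) \<Rightarrow> ennreal" where
  "Lp_opnorm p T = (SUP x \<in> {x \<in> Lp p. Lp_norm p x \<le> 1}. Lp_norm p (T x))"

lemma set_integral_cong_AE_lebesgue:
  fixes k f g :: "real \<Rightarrow> real"
  assumes k: "k \<in> borel_measurable borel" and E: "E \<in> sets borel"
    and [measurable]: "f \<in> borel_measurable lebesgue" "g \<in> borel_measurable lebesgue"
    and "AE s in lebesgue. f s = g s"
  shows "(LINT s:E|lebesgue. k s * f s) = (LINT s:E|lebesgue. k s * g s)"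
proof -
  have [measurable]: "k \<in> borel_measurable lebesgue"
    using k by (rule borel_imp_lebesgue_measurable)
  have [measurable]: "E \<in> sets lebesgue"
    using E by simp
  show ?thesis
    unfolding set_lebesgue_integral_def
    using assms(5) by (intro integral_cong_AE) (measurable, auto)
qed

lemma inverse_indicator_measurable:
  "(\<lambda>t. indicator {\<alpha>..} t * (\<gamma> / t) * c :: real) \<in> borel_measurable lebesgue"
  by (rule borel_imp_lebesgue_measurable) measurable

lemma kernel_A_eq:
  fixes \<alpha> \<gamma> t :: real and h :: "real \<Rightarrow> real"
  shows "(LINT s:{1..2}|lebesgue. indicator {\<alpha>..} t * (\<gamma> / t - 2 * \<gamma> * ln 2 / (t * s)) * h s)
     = indicator {\<alpha>..} t * (\<gamma> / t) * (LINT s:{1..2}|lebesgue. (1 - 2 * ln 2 / s) * h s)"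
proof -
  have "indicator {\<alpha>..} t * (\<gamma> / t - 2 * \<gamma> * ln 2 / (t * s)) * h s
      = indicator {\<alpha>..} t * (\<gamma> / t) * ((1 - 2 * ln 2 / s) * h s)" for s
    by (cases "t = 0"; cases "s = 0") (auto simp: field_simps)
  then show ?thesis
    by (simp only: set_integral_mult_right)
qed

lift_definition op_A :: "real \<Rightarrow> real \<Rightarrow> ae_fun \<Rightarrow> ae_fun" is
  "\<lambda>\<alpha> \<gamma> x t. LINT s:{1..2}|lebesgue.
     indicator {\<alpha>..} t * (\<gamma> / t - 2 * \<gamma> * ln 2 / (t * s)) * x s"
proof -
  fix \<alpha> \<gamma> :: real and f g :: "real \<Rightarrow> real"
  assume "f \<in> borel_measurable lebesgue \<and> g \<in> borel_measurable lebesgue \<and>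
    (AE t in lebesgue. f t = g t)"
  then have "(LINT s:{1..2}|lebesgue. (1 - 2 * ln 2 / s) * f s)
      = (LINT s:{1..2}|lebesgue. (1 - 2 * ln 2 / s) * g s)"
    by (intro set_integral_cong_AE_lebesgue) auto
  then show "(\<lambda>t. LINT s:{1..2}|lebesgue. indicator {\<alpha>..} t * (\<gamma> / t - 2 * \<gamma> * ln 2 / (t * s)) * f s) \<in> borel_measurable lebesgue \<and>
    (\<lambda>t. LINT s:{1..2}|lebesgue. indicator {\<alpha>..} t * (\<gamma> / t - 2 * \<gamma> * ln 2 / (t * s)) * g s) \<in> borel_measurable lebesgue \<and>
    (AE t in lebesgue.
      (LINT s:{1..2}|lebesgue. indicator {\<alpha>..} t * (\<gamma> / t - 2 * \<gamma> * ln 2 / (t * s)) * f s)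
      = (LINT s:{1..2}|lebesgue. indicator {\<alpha>..} t * (\<gamma> / t - 2 * \<gamma> * ln 2 / (t * s)) * g s))"
    unfolding kernel_A_eq by (simp only: inverse_indicator_measurable) simp
qed

lift_definition op_B :: "real \<Rightarrow> real \<Rightarrow> ae_fun \<Rightarrow> ae_fun" is
  "\<lambda>\<alpha> \<gamma> x t. LINT s:{1..2}|lebesgue. indicator {\<alpha>..} t * (\<gamma> / t) * x s"
proof -
  fix \<alpha> \<gamma> :: real and f g :: "real \<Rightarrow> real"
  assume "f \<in> borel_measurable lebesgue \<and> g \<in> borel_measurable lebesgue \<and>
    (AE t in lebesgue. f t = g t)"
  then have "(LINT s:{1..2}|lebesgue. f s) = (LINT s:{1..2}|lebesgue. g s)"
    using set_integral_cong_AE_lebesgue[of "\<lambda>_. 1" "{1..2}" f g] by auto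
  then show "(\<lambda>t. LINT s:{1..2}|lebesgue. indicator {\<alpha>..} t * (\<gamma> / t) * f s) \<in> borel_measurable lebesgue \<and>
    (\<lambda>t. LINT s:{1..2}|lebesgue. indicator {\<alpha>..} t * (\<gamma> / t) * g s) \<in> borel_measurable lebesgue \<and>
    (AE t in lebesgue.
      (LINT s:{1..2}|lebesgue. indicator {\<alpha>..} t * (\<gamma> / t) * f s)
      = (LINT s:{1..2}|lebesgue. indicator {\<alpha>..} t * (\<gamma> / t) * g s))"
    unfolding set_integral_mult_right by (simp only: inverse_indicator_measurable) simp
qed

text \<open>Both operators are given by integrals that converge absolutely on \<open>Lp p\<close>, and both map
  \<open>Lp p\<close> into itself.\<close>

lemma Lp_set_integrable:
  assumes "1 \<le> p" "x \<in> Lp p"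
  shows "set_integrable lebesgue {1..2} (rep_ae_fun x)"
proof -
  define f where "f = rep_ae_fun x"
  have "f \<in> borel_measurable lebesgue \<and> f \<in> borel_measurable lebesgue \<and> (AE t in lebesgue. f t = f t)"
    unfolding f_def by (rule Quotient_rep_reflp[OF Quotient_ae_fun])
  then have [measurable]: "f \<in> borel_measurable lebesgue" by simp
  have x: "x = abs_ae_fun f"
    unfolding f_def by (rule Quotient_abs_rep[OF Quotient_ae_fun, symmetric])
  have [measurable]: "{1..2::real} \<in> sets lebesgue" by simp
  have int1: "integrable lebesgue (\<lambda>t::real. indicator {1..2} t * c :: real)" for c
    by (rule integrable_mult_left) (simp add: integrable_indicator_iff)
  show ?thesis
  proof (cases "p = \<infinity>")
    case True
    have fin: "esssup lebesgue (\<lambda>t. ennreal \<bar>f t\<bar>) < \<infinity>"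
      using assms(2) True by (simp add: Lp_def x Lp_norm.abs_eq)
    then obtain c where c: "esssup lebesgue (\<lambda>t. ennreal \<bar>f t\<bar>) = ennreal c" "0 \<le> c"
      by (cases "esssup lebesgue (\<lambda>t. ennreal \<bar>f t\<bar>)") auto
    have "AE t in lebesgue. \<bar>f t\<bar> \<le> c"
      using esssup_AE[of "\<lambda>t. ennreal \<bar>f t\<bar>" lebesgue] c by simp
    then show ?thesis
      unfolding set_integrable_def f_def[symmetric]
      by (intro Bochner_Integration.integrable_bound[OF int1[of c]])
         (auto split: split_indicator elim!: eventually_mono)
  next
    case False
    define q where "q = enn2real p"
    have q: "1 \<le> q"
    proof -
      have "p = ennreal q" using False by (cases p) (auto simp: q_def)
      with assms(1) have "ennreal 1 \<le> ennreal q" by simp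
      then show ?thesis by (metis ennreal_le_iff2 not_one_le_zero zero_less_one not_le)
    qed
    have "(\<integral>\<^sup>+ t. ennreal (\<bar>f t\<bar> powr q) \<partial>lebesgue) < \<infinity>"
      using assms(2) False
      by (auto simp: Lp_def x Lp_norm.abs_eq Let_def q_def less_top split: if_splits)
    then have int2: "integrable lebesgue (\<lambda>t. \<bar>f t\<bar> powr q)"
      by (intro integrableI_bounded) auto
    have bound: "\<bar>y\<bar> \<le> 1 + \<bar>y\<bar> powr q" for y :: real
    proof (cases "\<bar>y\<bar> \<le> 1")
      case False
      then show ?thesis using powr_mono[of 1 q "\<bar>y\<bar>"] q by auto
    next
      case True
      then show ?thesis using powr_ge_zero[of "\<bar>y\<bar>" q] by linarith
    qed
    have "norm (indicator {1..2} t *\<^sub>R f t)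
        \<le> norm (indicator {1..2} t * 1 + \<bar>f t\<bar> powr q)" for t
      using bound[of "f t"] powr_ge_zero[of "\<bar>f t\<bar>" q]
      by (cases "t \<in> {1..2}") simp_all
    moreover have "(\<lambda>t. indicator {1..2} t *\<^sub>R f t) \<in> borel_measurable lebesgue"
      by measurable
    ultimately show ?thesis
      unfolding set_integrable_def f_def[symmetric]
      by (intro Bochner_Integration.integrable_bound[OF
            Bochner_Integration.integrable_add[OF int1[of 1] int2]] AE_I2)
  qed
qed

lemma inverse_indicator_in_Lp:
  fixes \<alpha> c :: real
  assumes "1 < p" "0 < \<alpha>"
  shows "abs_ae_fun (\<lambda>t. indicator {\<alpha>..} t * (\<gamma> / t) * c) \<in> Lp p"
proof -
  let ?f = "\<lambda>t. indicator {\<alpha>..} t * (\<gamma> / t) * c :: real"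
  have meas [measurable]: "?f \<in> borel_measurable lebesgue"
    by (rule inverse_indicator_measurable)
  show ?thesis
  proof (cases "p = \<infinity>")
    case True
    have "esssup lebesgue (\<lambda>t. ennreal \<bar>?f t\<bar>) \<le> ennreal (\<bar>\<gamma>\<bar> / \<alpha> * \<bar>c\<bar>)"
    proof (intro esssup_I AE_I2 ennreal_leI)
      show "\<bar>?f t\<bar> \<le> \<bar>\<gamma>\<bar> / \<alpha> * \<bar>c\<bar>" for t
        using assms(2)
        by (auto simp: abs_mult abs_divide split: split_indicator
            intro!: mult_right_mono divide_left_mono)
    qed measurable
    also have "\<dots> < \<infinity>" by simp
    finally show ?thesis
      using True meas by (simp add: Lp_def Lp_norm.abs_eq)
  next
    case False
    define q where "q = enn2real p"
    have q: "1 < q"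
    proof -
      have "p = ennreal q" using False by (cases p) (auto simp: q_def)
      with assms(1) have "ennreal 1 < ennreal q" by simp
      then show ?thesis by (subst (asm) ennreal_less_iff) auto
    qed
    define C where "C = (\<bar>\<gamma>\<bar> * \<bar>c\<bar>) powr q"
    define g where "g = (\<lambda>t. \<bar>t\<bar> powr (- q) * C)"
    define G where "G = (\<lambda>t. t powr (1 - q) / (1 - q) * C)"
    have "\<bar>?f t\<bar> powr q = g t * indicator {\<alpha>..} t" for t
      using assms(2)
      by (auto simp: g_def C_def abs_mult abs_divide powr_mult powr_divide powr_minus
          field_simps split: split_indicator)
    then have "(\<integral>\<^sup>+ t. ennreal (\<bar>?f t\<bar> powr q) \<partial>lebesgue)
        = (\<integral>\<^sup>+ t. ennreal (g t) * indicator {\<alpha>..} t \<partial>lebesgue)"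
      by (intro nn_integral_cong) (auto split: split_indicator)
    also have "\<dots> = (\<integral>\<^sup>+ t. ennreal (g t) * indicator {\<alpha>..} t \<partial>lborel)"
      by (rule nn_integral_completion)
    also have "\<dots> = ennreal (0 - G \<alpha>)"
    proof (rule nn_integral_FTC_atLeast)
      show "g \<in> borel_measurable borel" unfolding g_def by measurable
      show "0 \<le> g t" for t by (simp add: g_def C_def)
      show "DERIV G t :> g t" if "\<alpha> \<le> t" for t
      proof -
        have "t > 0" using that assms(2) by simp
        then have "DERIV (\<lambda>z. z powr (1 - q)) t :> (1 - q) * t powr (1 - q - 1)"
          by (rule has_real_derivative_powr)
        from DERIV_cmult_right[OF DERIV_cdivide[OF this, of "1 - q"], of C]
        show ?thesis
          using \<open>t > 0\<close> q by (simp add: G_def g_def)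
      qed
      have "((\<lambda>t::real. t powr (1 - q)) \<longlongrightarrow> 0) at_top"
        using q by (intro tendsto_neg_powr filterlim_ident) auto
      then have "((\<lambda>t. t powr (1 - q) / (1 - q) * C) \<longlongrightarrow> 0 / (1 - q) * C) at_top"
        using q by (intro tendsto_intros) auto
      then show "(G \<longlongrightarrow> 0) at_top" by (simp add: G_def)
    qed
    finally show ?thesis
      using False meas by (simp add: Lp_def Lp_norm.abs_eq Let_def q_def)
  qed
qed

lemma
  assumes "1 < p" "0 < \<alpha>"
  shows op_A_in_Lp: "op_A \<alpha> \<gamma> x \<in> Lp p" and op_B_in_Lp: "op_B \<alpha> \<gamma> x \<in> Lp p"
proof -
  define f where "f = rep_ae_fun x"
  have f: "f \<in> borel_measurable lebesgue \<and> f \<in> borel_measurable lebesgue \<and> (AE t in lebesgue. f t = f t)"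
    unfolding f_def by (rule Quotient_rep_reflp[OF Quotient_ae_fun])
  have x: "x = abs_ae_fun f"
    unfolding f_def by (rule Quotient_abs_rep[OF Quotient_ae_fun, symmetric])
  show "op_A \<alpha> \<gamma> x \<in> Lp p" "op_B \<alpha> \<gamma> x \<in> Lp p"
    using inverse_indicator_in_Lp[OF assms] f
    by (simp_all add: x op_A.abs_eq op_B.abs_eq kernel_A_eq)
qed

definition Params :: "(real \<times> real \<times> real) set" where
  "Params = {(a, b, \<alpha>). 0 < \<alpha> \<and> \<alpha> \<le> 1}"

end

theory Submission
  imports Defs
begin

text \<open>
  Both kernels factor into a function of \<open>t\<close> times a function of \<open>s\<close>, so the operators have rank
  at most one and map into the same line: with \<open>tail \<alpha>\<close> the class of \<open>1 / t\<close> cut off to \<open>t \<ge> \<alpha>\<close>,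
  \<open>A x = \<gamma>\<^sub>A \<psi>(x) tail \<alpha>\<close> and \<open>B x = \<gamma>\<^sub>B \<phi>(x) tail \<alpha>\<close>, where \<open>\<phi>\<close> (\<open>mean\<close>) integrates over
  \<open>[1, 2]\<close> and \<open>\<psi>\<close> (\<open>balanced\<close>) does so with the weight \<open>1 - 2 ln 2 / s\<close>
  (\<open>op_A_rank_one\<close>, \<open>op_B_rank_one\<close>). Products of the operators are therefore governed by two numbers.
  As \<open>\<alpha> \<le> 1\<close>, the cut-off is invisible on \<open>[1, 2]\<close>, so \<open>\<phi>(tail \<alpha>) = ln 2\<close>; the constant
  \<open>2 ln 2\<close> is the one for which \<open>\<psi>(tail \<alpha>) = 0\<close> (\<open>mean_tail\<close>, \<open>balanced_tail\<close>). Hence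
  \<open>A B = A\<^sup>2 = 0\<close>, and the commutator \<open>A B - B A = - B A\<close> has the same form,
  \<open>x \<mapsto> - \<gamma>\<^sub>A \<gamma>\<^sub>B ln 2 \<psi>(x) tail \<alpha>\<close> (\<open>commutator_eq\<close>).

  Convergence then reduces to two estimates. The functional \<open>\<psi>\<close> is bounded on the unit ball
  (\<open>balanced_unit_ball_le\<close>), so an operator \<open>x \<mapsto> c \<psi>(x) tail \<alpha>\<close> with \<open>\<alpha>\<close> fixed tends to \<open>0\<close>
  in norm as \<open>c\<close> does. For varying \<open>\<alpha>\<close> and fixed \<open>x\<close>, the norm of \<open>tail \<alpha>\<close>
  (\<open>Lp_norm_tail_le\<close>) contributes the factor \<open>\<alpha>\<close> to the power \<open>(1 - p) / p\<close>,
  or \<open>1 / \<alpha>\<close> if \<open>p = \<infinity>\<close>.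
\<close>

section \<open>Representatives\<close>

lemma rep_ae_fun_measurable: "rep_ae_fun x \<in> borel_measurable lebesgue"
  using Quotient_rep_reflp[OF Quotient_ae_fun, of x] by simp

lemma abs_rep_ae_fun: "abs_ae_fun (rep_ae_fun x) = x"
  by (rule Quotient_abs_rep[OF Quotient_ae_fun])

lemma rep_abs_ae_fun_AE:
  assumes "f \<in> borel_measurable lebesgue"
  shows "AE t in lebesgue. rep_ae_fun (abs_ae_fun f) t = f t"
  using Quotient_rep_abs[OF Quotient_ae_fun, of f] assms by simp

lemma set_integral_rep_abs_ae_fun:
  assumes "k \<in> borel_measurable borel" "E \<in> sets borel" "f \<in> borel_measurable lebesgue"
  shows "(LINT s:E|lebesgue. k s * rep_ae_fun (abs_ae_fun f) s) = (LINT s:E|lebesgue. k s * f s)"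
  by (rule set_integral_cong_AE_lebesgue
      [OF assms(1,2) rep_ae_fun_measurable assms(3) rep_abs_ae_fun_AE[OF assms(3)]])

lemma rep_uminus_ae_fun_AE:
  "AE t in lebesgue. rep_ae_fun (- x) t = - rep_ae_fun x t"
proof -
  have "- x = abs_ae_fun (\<lambda>t. - rep_ae_fun x t)"
    using uminus_ae_fun.abs_eq[of "rep_ae_fun x"] rep_ae_fun_measurable[of x]
    by (simp add: abs_rep_ae_fun)
  then show ?thesis
    using rep_abs_ae_fun_AE[of "\<lambda>t. - rep_ae_fun x t"] rep_ae_fun_measurable[of x] by simp
qed

section \<open>The operators as rank-one operators\<close>

definition mean :: "ae_fun \<Rightarrow> real" where
  "mean x = (LINT s:{1..2}|lebesgue. rep_ae_fun x s)"

definition balanced :: "ae_fun \<Rightarrow> real" where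
  "balanced x = (LINT s:{1..2}|lebesgue. (1 - 2 * ln 2 / s) * rep_ae_fun x s)"

definition tail :: "real \<Rightarrow> ae_fun" where
  "tail \<alpha> = abs_ae_fun (\<lambda>t. indicator {\<alpha>..} t * (1 / t))"

lemma scaleR_tail: "c *\<^sub>R tail \<alpha> = abs_ae_fun (\<lambda>t. c * (indicator {\<alpha>..} t * (1 / t)))"
  and tail_measurable:
    "(\<lambda>t. c * (indicator {\<alpha>..} t * (1 / t)) :: real) \<in> borel_measurable lebesgue"
proof -
  show m: "(\<lambda>t. c * (indicator {\<alpha>..} t * (1 / t)) :: real) \<in> borel_measurable lebesgue" for c
    by (rule borel_imp_lebesgue_measurable) measurable
  show "c *\<^sub>R tail \<alpha> = abs_ae_fun (\<lambda>t. c * (indicator {\<alpha>..} t * (1 / t)))"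
    unfolding tail_def using m[of 1] by (subst scaleR_ae_fun.abs_eq) simp_all
qed

lemma op_A_rank_one: "op_A \<alpha> \<gamma> x = (\<gamma> * balanced x) *\<^sub>R tail \<alpha>"
proof -
  have "op_A \<alpha> \<gamma> (abs_ae_fun (rep_ae_fun x))
      = abs_ae_fun (\<lambda>t. indicator {\<alpha>..} t * (\<gamma> / t) * balanced x)"
    using rep_ae_fun_measurable[of x]
    by (subst op_A.abs_eq) (simp_all only: kernel_A_eq balanced_def, simp)
  also have "(\<lambda>t. indicator {\<alpha>..} t * (\<gamma> / t) * balanced x)
      = (\<lambda>t. \<gamma> * balanced x * (indicator {\<alpha>..} t * (1 / t)))"
    by (rule ext) simp
  finally show ?thesis
    unfolding scaleR_tail abs_rep_ae_fun .
qed

lemma op_B_rank_one: "op_B \<alpha> \<gamma> x = (\<gamma> * mean x) *\<^sub>R tail \<alpha>"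
proof -
  have "op_B \<alpha> \<gamma> (abs_ae_fun (rep_ae_fun x))
      = abs_ae_fun (\<lambda>t. indicator {\<alpha>..} t * (\<gamma> / t) * mean x)"
    using rep_ae_fun_measurable[of x]
    by (subst op_B.abs_eq) (simp_all only: set_integral_mult_right mean_def, simp)
  also have "(\<lambda>t. indicator {\<alpha>..} t * (\<gamma> / t) * mean x)
      = (\<lambda>t. \<gamma> * mean x * (indicator {\<alpha>..} t * (1 / t)))"
    by (rule ext) simp
  finally show ?thesis
    unfolding scaleR_tail abs_rep_ae_fun .
qed

lemma set_integral_FTC_1_2:
  fixes f F :: "real \<Rightarrow> real"
  assumes "\<And>s. 1 \<le> s \<Longrightarrow> s \<le> 2 \<Longrightarrow> (F has_real_derivative f s) (at s)"
    and "continuous_on {1..2} f"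
  shows "(LINT s:{1..2}|lebesgue. f s) = F 2 - F 1"
proof -
  have "(LINT s:{1..2}|lebesgue. f s) = integral {1..2} f"
    by (intro set_lebesgue_integral_eq_integral(2) absolutely_integrable_continuous_real assms(2))
  also have "(f has_integral (F 2 - F 1)) {1..2}"
    using assms(1)
    by (intro fundamental_theorem_of_calculus)
       (auto simp: has_real_derivative_iff_has_vector_derivative[symmetric]
         intro: DERIV_subset)
  then have "integral {1..2} f = F 2 - F 1"
    by (rule integral_unique)
  finally show ?thesis .
qed

lemma mean_tail:
  assumes "\<alpha> \<le> 1"
  shows "mean (c *\<^sub>R tail \<alpha>) = c * ln 2"
proof -
  have "mean (c *\<^sub>R tail \<alpha>) = (LINT s:{1..2}|lebesgue. 1 * (c * (indicator {\<alpha>..} s * (1 / s))))"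
    using set_integral_rep_abs_ae_fun[of "\<lambda>_. 1" "{1..2}", OF _ _ tail_measurable[of c \<alpha>]]
    by (simp add: mean_def scaleR_tail)
  also have "\<dots> = (LINT s:{1..2}|lebesgue. c * (1 / s))"
    using assms by (intro set_lebesgue_integral_cong) auto
  also have "\<dots> = c * ln 2 - c * ln 1"
    by (rule set_integral_FTC_1_2)
       (auto intro!: derivative_eq_intros continuous_intros)
  finally show ?thesis by simp
qed

text \<open>The weight \<open>1 - 2 ln 2 / s\<close> is orthogonal to \<open>1 / s\<close> on \<open>[1, 2]\<close>, because the integrals of
  \<open>1 / s\<close> and \<open>1 / s\<^sup>2\<close> there are \<open>ln 2\<close> and \<open>1 / 2\<close>.\<close>

lemma balanced_tail:
  assumes "\<alpha> \<le> 1"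
  shows "balanced (c *\<^sub>R tail \<alpha>) = 0"
proof -
  have "balanced (c *\<^sub>R tail \<alpha>)
      = (LINT s:{1..2}|lebesgue. (1 - 2 * ln 2 / s) * (c * (indicator {\<alpha>..} s * (1 / s))))"
    unfolding balanced_def scaleR_tail
    by (intro set_integral_rep_abs_ae_fun tail_measurable) auto
  also have "\<dots> = (LINT s:{1..2}|lebesgue. c * (1 / s - 2 * ln 2 / s ^ 2))"
    using assms
    by (intro set_lebesgue_integral_cong) (auto simp: field_simps power2_eq_square)
  also have "\<dots> = c * (ln 2 + 2 * ln 2 / 2) - c * (ln 1 + 2 * ln 2 / 1)"
    by (rule set_integral_FTC_1_2)
       (auto intro!: derivative_eq_intros continuous_intros simp: field_simps power2_eq_square)
  finally show ?thesis by simp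
qed

lemma AB_eq_0:
  assumes "\<alpha> \<le> 1"
  shows "op_A \<alpha> \<gamma> (op_B \<alpha> \<gamma>' x) = 0"
  by (simp add: op_A_rank_one[of \<alpha> \<gamma>] op_B_rank_one balanced_tail[OF assms])

lemma BAA_eq_0:
  assumes "\<alpha> \<le> 1"
  shows "op_B \<alpha> \<gamma>' (op_A \<alpha> \<gamma> (op_A \<alpha> \<gamma> x)) = 0"
  using mean_tail[OF assms, of 0]
  by (simp add: op_A_rank_one op_B_rank_one balanced_tail[OF assms])

lemma BA_eq:
  assumes "\<alpha> \<le> 1"
  shows "op_B \<alpha> \<gamma>' (op_A \<alpha> \<gamma> x) = (\<gamma> * \<gamma>' * ln 2 * balanced x) *\<^sub>R tail \<alpha>"
  by (simp add: op_A_rank_one op_B_rank_one mean_tail[OF assms] mult_ac)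

lemma commutator_eq:
  assumes "\<alpha> \<le> 1"
  shows "op_A \<alpha> \<gamma> (op_B \<alpha> \<gamma>' x) - op_B \<alpha> \<gamma>' (op_A \<alpha> \<gamma> x)
    = (- (\<gamma> * \<gamma>' * ln 2 * balanced x)) *\<^sub>R tail \<alpha>"
  by (simp add: AB_eq_0[OF assms] BA_eq[OF assms])

section \<open>Norm estimates\<close>

text \<open>For \<open>1 < p < \<infinity>\<close> and \<open>\<alpha> > 0\<close> this is the exact norm of \<open>tail \<alpha>\<close>: the integral of \<open>t\<close> to the power \<open>- p\<close> over
  \<open>[\<alpha>, \<infinity>[\<close> is \<open>\<alpha>\<close> to the power \<open>1 - p\<close>, divided by \<open>p - 1\<close>.\<close>

definition tail_norm :: "ennreal \<Rightarrow> real \<Rightarrow> real" where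
  "tail_norm p \<alpha> = (if p = \<infinity> then 1 / \<alpha>
     else \<alpha> powr ((1 - enn2real p) / enn2real p) / (enn2real p - 1) powr (1 / enn2real p))"

lemma one_less_enn2real:
  assumes "1 < p" "p \<noteq> \<infinity>"
  shows "1 < enn2real p"
  using assms by (cases p) (auto simp flip: ennreal_1 simp: ennreal_less_iff)

lemma nn_integral_tail_powr:
  fixes \<alpha> q :: real
  assumes "1 < q" "0 < \<alpha>"
  shows "(\<integral>\<^sup>+ t. ennreal (\<bar>c * (indicator {\<alpha>..} t * (1 / t))\<bar> powr q) \<partial>lebesgue)
    = ennreal (\<bar>c\<bar> powr q * \<alpha> powr (1 - q) / (q - 1))"
proof -
  define C where "C = \<bar>c\<bar> powr q"
  have "(\<integral>\<^sup>+ t. ennreal (\<bar>c * (indicator {\<alpha>..} t * (1 / t))\<bar> powr q) \<partial>lebesgue)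
      = (\<integral>\<^sup>+ t. ennreal (C * \<bar>t\<bar> powr (- q)) * indicator {\<alpha>..} t \<partial>lebesgue)"
    using assms(2)
    by (intro nn_integral_cong)
       (auto simp: C_def abs_mult powr_mult powr_divide powr_minus field_simps
         split: split_indicator)
  also have "\<dots> = (\<integral>\<^sup>+ t. ennreal (C * \<bar>t\<bar> powr (- q)) * indicator {\<alpha>..} t \<partial>lborel)"
    by (rule nn_integral_completion)
  also have "\<dots> = ennreal (0 - C * (\<alpha> powr (1 - q) / (1 - q)))"
  proof (rule nn_integral_FTC_atLeast[where F = "\<lambda>t. C * (t powr (1 - q) / (1 - q))"])
    show "((\<lambda>t. C * (t powr (1 - q) / (1 - q))) has_real_derivative C * \<bar>t\<bar> powr (- q)) (at t)"
      if "\<alpha> \<le> t" for t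
    proof -
      have t: "0 < t" using that assms(2) by simp
      then have "((\<lambda>z. z powr (1 - q)) has_real_derivative (1 - q) * t powr (1 - q - 1)) (at t)"
        by (rule has_real_derivative_powr)
      from DERIV_cmult[OF DERIV_cdivide[OF this, of "1 - q"], of C] show ?thesis
        using t assms(1) by simp
    qed
    have "((\<lambda>t::real. t powr (1 - q)) \<longlongrightarrow> 0) at_top"
      using assms(1) by (intro tendsto_neg_powr filterlim_ident) auto
    then have "((\<lambda>t. C * (t powr (1 - q) / (1 - q))) \<longlongrightarrow> C * (0 / (1 - q))) at_top"
      using assms(1) by (intro tendsto_intros) auto
    then show "((\<lambda>t. C * (t powr (1 - q) / (1 - q))) \<longlongrightarrow> 0) at_top" by simp
  qed (auto simp: C_def)
  also have "0 - C * (\<alpha> powr (1 - q) / (1 - q)) = \<bar>c\<bar> powr q * \<alpha> powr (1 - q) / (q - 1)"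
    using assms(1) by (simp add: C_def field_simps)
  finally show ?thesis .
qed

lemma Lp_norm_tail_le:
  assumes "1 < p" "0 < \<alpha>"
  shows "Lp_norm p (c *\<^sub>R tail \<alpha>) \<le> ennreal (\<bar>c\<bar> * tail_norm p \<alpha>)"
proof (cases "p = \<infinity>")
  case True
  have "esssup lebesgue (\<lambda>t. ennreal \<bar>c * (indicator {\<alpha>..} t * (1 / t))\<bar>) \<le> ennreal (\<bar>c\<bar> * (1 / \<alpha>))"
  proof (intro esssup_I AE_I2 ennreal_leI)
    show "\<bar>c * (indicator {\<alpha>..} t * (1 / t))\<bar> \<le> \<bar>c\<bar> * (1 / \<alpha>)" for t
      using assms(2)
      by (auto simp: abs_mult split: split_indicator intro!: divide_left_mono)
  qed (use tail_measurable[of c \<alpha>] in measurable)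
  then show ?thesis
    using True tail_measurable[of c \<alpha>] by (simp add: scaleR_tail Lp_norm.abs_eq tail_norm_def)
next
  case False
  define q where "q = enn2real p"
  have q: "1 < q"
    unfolding q_def using assms(1) False by (rule one_less_enn2real)
  have "(\<bar>c\<bar> powr q * \<alpha> powr (1 - q) / (q - 1)) powr (1 / q) = \<bar>c\<bar> * tail_norm p \<alpha>"
    using q False assms(2)
    by (simp add: tail_norm_def q_def[symmetric] powr_divide powr_mult powr_powr)
  then show ?thesis
    using False q tail_measurable[of c \<alpha>]
    by (simp add: scaleR_tail Lp_norm.abs_eq Let_def q_def[symmetric]
        nn_integral_tail_powr[OF q assms(2)] del: mult_1_right times_divide_eq_right)
qed

lemma abs_le_1_plus_powr:
  fixes y q :: real
  assumes "1 \<le> q"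
  shows "\<bar>y\<bar> \<le> 1 + \<bar>y\<bar> powr q"
proof (cases "\<bar>y\<bar> \<le> 1")
  case False
  then show ?thesis using powr_mono[of 1 q "\<bar>y\<bar>"] assms by auto
next
  case True
  then show ?thesis using powr_ge_zero[of "\<bar>y\<bar>" q] by linarith
qed

text \<open>For finite \<open>p\<close>, integrating \<open>\<bar>y\<bar> \<le> 1 + \<bar>y\<bar>\<^sup>p\<close> over \<open>[1, 2]\<close>, a set of measure one,
  gives a bound that is uniform on the unit ball; for \<open>p = \<infinity>\<close> the integrand is at most \<open>1\<close>. The best constant, which the Hoelder inequality gives, is \<open>1\<close>, but
  any constant suffices for convergence to \<open>0\<close>.\<close>

lemma nn_integral_unit_ball_le:
  assumes "1 < p" "Lp_norm p x \<le> 1"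
  shows "(\<integral>\<^sup>+ s. ennreal \<bar>rep_ae_fun x s\<bar> * indicator {1..2} s \<partial>lebesgue) \<le> 2"
proof -
  define f where "f = rep_ae_fun x"
  have m [measurable]: "f \<in> borel_measurable lebesgue"
    unfolding f_def by (rule rep_ae_fun_measurable)
  have norm: "Lp_norm r x = Lp_norm r (abs_ae_fun f)" for r
    by (simp add: f_def abs_rep_ae_fun)
  have E [measurable]: "{1..2::real} \<in> sets lebesgue" by simp
  have emE: "emeasure lebesgue {1..2::real} = 1" by simp
  show ?thesis
  proof (cases "p = \<infinity>")
    case True
    have ess: "esssup lebesgue (\<lambda>t. ennreal \<bar>f t\<bar>) \<le> 1"
      using assms(2) True by (simp add: norm Lp_norm.abs_eq m)
    have "AE t in lebesgue. ennreal \<bar>f t\<bar> \<le> 1"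
      using esssup_AE[of "\<lambda>t. ennreal \<bar>f t\<bar>" lebesgue] ess
      by (auto elim!: eventually_mono intro: order_trans simp del: ennreal_le_1)
    then have "(\<integral>\<^sup>+ s. ennreal \<bar>f s\<bar> * indicator {1..2} s \<partial>lebesgue)
        \<le> (\<integral>\<^sup>+ s. indicator {1..2::real} s \<partial>lebesgue)"
      by (intro nn_integral_mono_AE) (auto split: split_indicator elim!: eventually_mono)
    also have "\<dots> = 1"
      using emE by (simp del: emeasure_lborel_Icc)
    also have "\<dots> \<le> 2" by simp
    finally show ?thesis unfolding f_def .
  next
    case False
    define q where "q = enn2real p"
    have q: "1 < q"
      unfolding q_def using assms(1) False by (rule one_less_enn2real)
    define I where "I = (\<integral>\<^sup>+ t. ennreal (\<bar>f t\<bar> powr q) \<partial>lebesgue)"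
    have "Lp_norm p x = (if I = \<infinity> then \<infinity> else ennreal (enn2real I powr (1 / q)))"
      using False by (simp add: norm Lp_norm.abs_eq m Let_def q_def I_def)
    then have le: "(if I = \<infinity> then \<infinity> else ennreal (enn2real I powr (1 / q))) \<le> 1"
      using assms(2) by simp
    then have fin: "I \<noteq> \<infinity>" by (auto simp: top_unique)
    have "enn2real I powr (1 / q) \<le> 1" using le fin by simp
    then have "(enn2real I powr (1 / q)) powr q \<le> 1 powr q"
      using q by (intro powr_mono2) auto
    then have "enn2real I \<le> 1" using q by (simp add: powr_powr)
    then have I: "I \<le> 1"
      using fin by (cases I) auto
    have "(\<integral>\<^sup>+ s. ennreal \<bar>f s\<bar> * indicator {1..2} s \<partial>lebesgue)
        \<le> (\<integral>\<^sup>+ s. indicator {1..2::real} s + ennreal (\<bar>f s\<bar> powr q) \<partial>lebesgue)"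
    proof (intro nn_integral_mono)
      have "ennreal \<bar>f s\<bar> \<le> 1 + ennreal (\<bar>f s\<bar> powr q)" for s
        using ennreal_leI[OF abs_le_1_plus_powr[of q "f s"]] q by (simp add: ennreal_plus)
      then show "ennreal \<bar>f s\<bar> * indicator {1..2} s
          \<le> indicator {1..2} s + ennreal (\<bar>f s\<bar> powr q)" for s
        by (cases "s \<in> {1..2}") simp_all
    qed
    also have "\<dots> = (\<integral>\<^sup>+ s. indicator {1..2::real} s \<partial>lebesgue) + I"
      unfolding I_def by (intro nn_integral_add) auto
    also have "\<dots> \<le> 1 + 1"
      using I emE by (intro add_mono) (simp_all del: emeasure_lborel_Icc)
    finally show ?thesis unfolding f_def by simp
  qed
qed

text \<open>The constant is \<open>3 * 2\<close>: the weight is at most \<open>1 + 2 ln 2 \<le> 3\<close> in absolute value on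
  \<open>[1, 2]\<close>, and the integral of \<open>\<bar>x\<bar>\<close> is at most \<open>2\<close>.\<close>

lemma balanced_unit_ball_le:
  assumes "1 < p" "Lp_norm p x \<le> 1"
  shows "\<bar>balanced x\<bar> \<le> 6"
proof -
  define f where "f = rep_ae_fun x"
  have [measurable]: "f \<in> borel_measurable lebesgue"
    unfolding f_def by (rule rep_ae_fun_measurable)
  have [measurable]: "(\<lambda>s::real. 1 - 2 * ln 2 / s) \<in> borel_measurable lebesgue"
    by (rule borel_imp_lebesgue_measurable) measurable
  have kernel: "\<bar>1 - 2 * ln 2 / s\<bar> \<le> 3" if "s \<in> {1..2}" for s :: real
  proof -
    have "0 \<le> 2 * ln 2 / s" "2 * ln 2 / s \<le> 2 * ln 2 / 1"
      using that by (simp, intro divide_left_mono) auto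
    moreover have "ln (2::real) \<le> 1" using ln_le_minus_one[of "2::real"] by simp
    ultimately show ?thesis by linarith
  qed
  have "ennreal \<bar>balanced x\<bar>
      \<le> (\<integral>\<^sup>+ s. ennreal (norm (indicator {1..2} s *\<^sub>R ((1 - 2 * ln 2 / s) * f s))) \<partial>lebesgue)"
    unfolding balanced_def set_lebesgue_integral_def f_def[symmetric] real_norm_def[symmetric]
    (* a function that is not integrable has integral 0 by convention *)
    by (cases "integrable lebesgue (\<lambda>s. indicator {1..2} s *\<^sub>R ((1 - 2 * ln 2 / s) * f s))")
       (rule integral_norm_bound_ennreal, assumption, subst not_integrable_integral_eq, simp_all)
  also have "\<dots> \<le> (\<integral>\<^sup>+ s. 3 * (ennreal \<bar>f s\<bar> * indicator {1..2} s) \<partial>lebesgue)"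
  proof (intro nn_integral_mono)
    show "ennreal (norm (indicator {1..2} s *\<^sub>R ((1 - 2 * ln 2 / s) * f s)))
        \<le> 3 * (ennreal \<bar>f s\<bar> * indicator {1..2} s)" for s
    proof (cases "s \<in> {1..2}")
      case True
      have "ennreal (\<bar>1 - 2 * ln 2 / s\<bar> * \<bar>f s\<bar>) \<le> ennreal (3 * \<bar>f s\<bar>)"
        using kernel[OF True] by (intro ennreal_leI mult_right_mono) auto
      then show ?thesis using True by (simp add: abs_mult ennreal_mult)
    qed simp
  qed
  also have "\<dots> = 3 * (\<integral>\<^sup>+ s. ennreal \<bar>f s\<bar> * indicator {1..2} s \<partial>lebesgue)"
    by (intro nn_integral_cmult borel_measurable_times_ennreal borel_measurable_indicator) auto
  also have "\<dots> \<le> 3 * 2"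
    unfolding f_def by (intro mult_left_mono nn_integral_unit_ball_le[OF assms]) auto
  also have "\<dots> = ennreal 6" by simp
  finally show ?thesis by (subst (asm) ennreal_le_iff) auto
qed

lemma Lp_opnorm_rank_one_le:
  assumes "1 < p" "0 < \<alpha>"
  shows "Lp_opnorm p (\<lambda>x. (c * balanced x) *\<^sub>R tail \<alpha>) \<le> ennreal (\<bar>c\<bar> * (6 * tail_norm p \<alpha>))"
  unfolding Lp_opnorm_def
proof (rule SUP_least)
  fix x assume x: "x \<in> {x \<in> Lp p. Lp_norm p x \<le> 1}"
  have nonneg: "0 \<le> tail_norm p \<alpha>" using assms(2) by (simp add: tail_norm_def)
  have "Lp_norm p ((c * balanced x) *\<^sub>R tail \<alpha>) \<le> ennreal (\<bar>c * balanced x\<bar> * tail_norm p \<alpha>)"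
    by (rule Lp_norm_tail_le[OF assms])
  also have "\<dots> \<le> ennreal (\<bar>c\<bar> * 6 * tail_norm p \<alpha>)"
    using x nonneg balanced_unit_ball_le[OF assms(1)]
    by (intro ennreal_leI mult_right_mono) (auto simp: abs_mult intro!: mult_left_mono)
  finally show "Lp_norm p ((c * balanced x) *\<^sub>R tail \<alpha>) \<le> ennreal (\<bar>c\<bar> * (6 * tail_norm p \<alpha>))"
    by (simp only: mult.assoc)
qed

lemma tendsto_0_ennreal_le:
  fixes f :: "'a \<Rightarrow> ennreal"
  assumes "eventually (\<lambda>x. f x \<le> ennreal (\<bar>g x\<bar> * K)) F" "(g \<longlongrightarrow> 0) F"
  shows "(f \<longlongrightarrow> 0) F"
proof (rule tendsto_sandwich[OF _ assms(1) tendsto_const])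
  have "((\<lambda>x. \<bar>g x\<bar> * K) \<longlongrightarrow> \<bar>0\<bar> * K) F"
    using assms(2) by (intro tendsto_intros)
  then show "((\<lambda>x. ennreal (\<bar>g x\<bar> * K)) \<longlongrightarrow> 0) F"
    using tendsto_ennrealI by fastforce
qed simp

lemma Lp_opnorm_rank_one_tendsto_0:
  assumes "1 < p" "0 < \<alpha>" "(c \<longlongrightarrow> 0) F"
  shows "((\<lambda>n. Lp_opnorm p (\<lambda>x. (c n * balanced x) *\<^sub>R tail \<alpha>)) \<longlongrightarrow> 0) F"
  by (rule tendsto_0_ennreal_le[OF always_eventually assms(3), where K = "6 * tail_norm p \<alpha>"])
     (intro allI Lp_opnorm_rank_one_le assms(1,2))

text \<open>With \<open>x\<close> fixed, \<open>balanced x\<close> is just a number, so everything that varies with the parameters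
  is in the factor \<open>a * b * tail_norm p r\<close>.\<close>

lemma commutator_tendsto_0:
  fixes F :: "(real \<times> real \<times> real) filter"
  assumes "1 < p" and "eventually (\<lambda>l. l \<in> Params) F"
    and "((\<lambda>(a, b, r). a * b * tail_norm p r) \<longlongrightarrow> 0) F"
  shows "((\<lambda>(a, b, r). Lp_norm p (op_A r a (op_B r b x) - op_B r b (op_A r a x))) \<longlongrightarrow> 0) F"
proof (rule tendsto_0_ennreal_le[OF _ assms(3), where K = "\<bar>ln 2 * balanced x\<bar>"])
  have "Lp_norm p (op_A r a (op_B r b x) - op_B r b (op_A r a x))
      \<le> ennreal (\<bar>a * b * tail_norm p r\<bar> * \<bar>ln 2 * balanced x\<bar>)"
    if "(a, b, r) \<in> Params" for a b r
  proof -
    have r: "0 < r" "r \<le> 1" using that by (auto simp: Params_def)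
    have "0 \<le> tail_norm p r" using r by (simp add: tail_norm_def)
    then show ?thesis
      using Lp_norm_tail_le[OF assms(1) r(1), of "- (a * b * ln 2 * balanced x)"]
      by (simp add: commutator_eq[OF r(2)] abs_mult mult_ac)
  qed
  then show "eventually (\<lambda>l. (case l of (a, b, r) \<Rightarrow>
        Lp_norm p (op_A r a (op_B r b x) - op_B r b (op_A r a x)))
      \<le> ennreal (\<bar>case l of (a, b, r) \<Rightarrow> a * b * tail_norm p r\<bar> * \<bar>ln 2 * balanced x\<bar>)) F"
    using assms(2) by (auto elim!: eventually_mono)
qed

theorem theorem9:
  fixes p :: ennreal and \<gamma>A \<gamma>B \<alpha> :: real and \<gamma> :: "nat \<Rightarrow> real"
  assumes "1 < p" and "0 < \<alpha>" and "\<alpha> \<le> 1"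
  shows
    "(\<forall>\<delta>::real.
        (\<forall>x \<in> Lp p.
           op_A \<alpha> \<gamma>A (op_B \<alpha> \<gamma>B x) = \<delta> *\<^sub>R op_B \<alpha> \<gamma>B (op_A \<alpha> \<gamma>A (op_A \<alpha> \<gamma>A x)) \<and>
           \<delta> *\<^sub>R op_B \<alpha> \<gamma>B (op_A \<alpha> \<gamma>A (op_A \<alpha> \<gamma>A x)) = 0) \<and>
        (\<forall>n \<ge> 1. \<forall>x \<in> Lp p.
           op_A \<alpha> (\<gamma> n) (op_B \<alpha> \<gamma>B x) = \<delta> *\<^sub>R op_B \<alpha> \<gamma>B (op_A \<alpha> (\<gamma> n) (op_A \<alpha> (\<gamma> n) x)))) \<and>
     (\<forall>x \<in> Lp p.
        (AE t in lebesgue.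
           rep_ae_fun (op_A \<alpha> \<gamma>A (op_B \<alpha> \<gamma>B x) - op_B \<alpha> \<gamma>B (op_A \<alpha> \<gamma>A x)) t
             = - rep_ae_fun (op_B \<alpha> \<gamma>B (op_A \<alpha> \<gamma>A x)) t \<and>
           - rep_ae_fun (op_B \<alpha> \<gamma>B (op_A \<alpha> \<gamma>A x)) t
             = - (\<gamma>A * \<gamma>B * ln 2) *
                 (LINT s:{1..2}|lebesgue.
                    indicator {\<alpha>..} t * (1 / t) * (1 - 2 * ln 2 / s) * rep_ae_fun x s))) \<and>
     (\<gamma> \<longlonglongrightarrow> 0 \<longrightarrow>
        (\<lambda>n. Lp_opnorm p (op_A \<alpha> (\<gamma> n))) \<longlonglongrightarrow> 0 \<and>
        (\<lambda>n. Lp_opnorm p (\<lambda>x. op_A \<alpha> (\<gamma> n) (op_B \<alpha> \<gamma>B x) - op_B \<alpha> \<gamma>B (op_A \<alpha> (\<gamma> n) x)))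
          \<longlonglongrightarrow> 0) \<and>
     (\<forall>l0 \<in> closure Params. \<forall>F. F \<le> inf (nhds l0) (principal Params) \<longrightarrow>
        (p < \<infinity> \<and>
           ((\<lambda>(a, b, r). a * b * r powr ((1 - enn2real p) / enn2real p)) \<longlongrightarrow> 0) F \<or>
         p = \<infinity> \<and> ((\<lambda>(a, b, r). a * b * (1 / r)) \<longlongrightarrow> 0) F) \<longrightarrow>
        (\<forall>x \<in> Lp p.
           ((\<lambda>(a, b, r). Lp_norm p (op_A r a (op_B r b x) - op_B r b (op_A r a x))) \<longlongrightarrow> 0) F))"
proof (intro conjI)
  have AB: "op_A \<alpha> \<gamma>1 (op_B \<alpha> \<gamma>2 x) = 0"
    and BAA: "op_B \<alpha> \<gamma>2 (op_A \<alpha> \<gamma>1 (op_A \<alpha> \<gamma>1 x)) = 0" for \<gamma>1 \<gamma>2 x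
    by (rule AB_eq_0[OF assms(3)], rule BAA_eq_0[OF assms(3)])
  show "\<forall>\<delta>::real.
        (\<forall>x \<in> Lp p.
           op_A \<alpha> \<gamma>A (op_B \<alpha> \<gamma>B x) = \<delta> *\<^sub>R op_B \<alpha> \<gamma>B (op_A \<alpha> \<gamma>A (op_A \<alpha> \<gamma>A x)) \<and>
           \<delta> *\<^sub>R op_B \<alpha> \<gamma>B (op_A \<alpha> \<gamma>A (op_A \<alpha> \<gamma>A x)) = 0) \<and>
        (\<forall>n \<ge> 1. \<forall>x \<in> Lp p.
           op_A \<alpha> (\<gamma> n) (op_B \<alpha> \<gamma>B x) = \<delta> *\<^sub>R op_B \<alpha> \<gamma>B (op_A \<alpha> (\<gamma> n) (op_A \<alpha> (\<gamma> n) x)))"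
    by (simp add: AB BAA)
  show "\<forall>x \<in> Lp p.
        (AE t in lebesgue.
           rep_ae_fun (op_A \<alpha> \<gamma>A (op_B \<alpha> \<gamma>B x) - op_B \<alpha> \<gamma>B (op_A \<alpha> \<gamma>A x)) t
             = - rep_ae_fun (op_B \<alpha> \<gamma>B (op_A \<alpha> \<gamma>A x)) t \<and>
           - rep_ae_fun (op_B \<alpha> \<gamma>B (op_A \<alpha> \<gamma>A x)) t
             = - (\<gamma>A * \<gamma>B * ln 2) *
                 (LINT s:{1..2}|lebesgue.
                    indicator {\<alpha>..} t * (1 / t) * (1 - 2 * ln 2 / s) * rep_ae_fun x s))"
  proof
    fix x
    let ?y = "op_B \<alpha> \<gamma>B (op_A \<alpha> \<gamma>A x)" and ?c = "\<gamma>A * \<gamma>B * ln 2 * balanced x"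
    have integral: "(LINT s:{1..2}|lebesgue.
          indicator {\<alpha>..} t * (1 / t) * (1 - 2 * ln 2 / s) * rep_ae_fun x s)
        = indicator {\<alpha>..} t * (1 / t) * balanced x" for t
      unfolding balanced_def by (simp only: mult.assoc set_integral_mult_right)
    have "AE t in lebesgue. rep_ae_fun ?y t = ?c * (indicator {\<alpha>..} t * (1 / t))"
      unfolding BA_eq[OF assms(3)] scaleR_tail by (rule rep_abs_ae_fun_AE[OF tail_measurable])
    with rep_uminus_ae_fun_AE[of ?y]
    show "AE t in lebesgue.
           rep_ae_fun (op_A \<alpha> \<gamma>A (op_B \<alpha> \<gamma>B x) - ?y) t = - rep_ae_fun ?y t \<and>
           - rep_ae_fun ?y t = - (\<gamma>A * \<gamma>B * ln 2) *
                 (LINT s:{1..2}|lebesgue.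
                    indicator {\<alpha>..} t * (1 / t) * (1 - 2 * ln 2 / s) * rep_ae_fun x s)"
      unfolding integral AB diff_0 by eventually_elim simp
  qed
  show "\<gamma> \<longlonglongrightarrow> 0 \<longrightarrow>
        (\<lambda>n. Lp_opnorm p (op_A \<alpha> (\<gamma> n))) \<longlonglongrightarrow> 0 \<and>
        (\<lambda>n. Lp_opnorm p (\<lambda>x. op_A \<alpha> (\<gamma> n) (op_B \<alpha> \<gamma>B x) - op_B \<alpha> \<gamma>B (op_A \<alpha> (\<gamma> n) x)))
          \<longlonglongrightarrow> 0"
  proof (intro impI conjI)
    assume lim: "\<gamma> \<longlonglongrightarrow> 0"
    have "op_A \<alpha> (\<gamma> n) = (\<lambda>x. (\<gamma> n * balanced x) *\<^sub>R tail \<alpha>)" for n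
      by (rule ext) (rule op_A_rank_one)
    then show "(\<lambda>n. Lp_opnorm p (op_A \<alpha> (\<gamma> n))) \<longlonglongrightarrow> 0"
      using Lp_opnorm_rank_one_tendsto_0[OF assms(1,2) lim] by simp
    have "(\<lambda>n. - (\<gamma> n * \<gamma>B * ln 2)) \<longlonglongrightarrow> - (0 * \<gamma>B * ln 2)"
      by (intro tendsto_intros lim)
    then have "(\<lambda>n. - (\<gamma> n * \<gamma>B * ln 2)) \<longlonglongrightarrow> 0" by simp
    from Lp_opnorm_rank_one_tendsto_0[OF assms(1,2) this]
    show "(\<lambda>n. Lp_opnorm p (\<lambda>x. op_A \<alpha> (\<gamma> n) (op_B \<alpha> \<gamma>B x) - op_B \<alpha> \<gamma>B (op_A \<alpha> (\<gamma> n) x)))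
        \<longlonglongrightarrow> 0"
      by (simp add: commutator_eq[OF assms(3)])
  qed
  show "\<forall>l0 \<in> closure Params. \<forall>F. F \<le> inf (nhds l0) (principal Params) \<longrightarrow>
        (p < \<infinity> \<and>
           ((\<lambda>(a, b, r). a * b * r powr ((1 - enn2real p) / enn2real p)) \<longlongrightarrow> 0) F \<or>
         p = \<infinity> \<and> ((\<lambda>(a, b, r). a * b * (1 / r)) \<longlongrightarrow> 0) F) \<longrightarrow>
        (\<forall>x \<in> Lp p.
           ((\<lambda>(a, b, r). Lp_norm p (op_A r a (op_B r b x) - op_B r b (op_A r a x))) \<longlongrightarrow> 0) F)"
  proof (intro ballI allI impI)
    fix l0 F x
    assume "F \<le> inf (nhds l0) (principal Params)"
    then have params: "eventually (\<lambda>l. l \<in> Params) F"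
      by (simp add: le_principal)
    assume lim: "p < \<infinity> \<and>
           ((\<lambda>(a, b, r). a * b * r powr ((1 - enn2real p) / enn2real p)) \<longlongrightarrow> 0) F \<or>
         p = \<infinity> \<and> ((\<lambda>(a, b, r). a * b * (1 / r)) \<longlongrightarrow> 0) F"
    have "((\<lambda>(a, b, r). a * b * tail_norm p r) \<longlongrightarrow> 0) F"
    proof (cases "p = \<infinity>")
      case True
      then show ?thesis using lim by (simp add: tail_norm_def)
    next
      case False
      with lim have "((\<lambda>(a, b, r). a * b * r powr ((1 - enn2real p) / enn2real p)) \<longlongrightarrow> 0) F"
        by simp
      from tendsto_divide_zero[OF this, of "(enn2real p - 1) powr (1 / enn2real p)"]
      show ?thesis using False by (simp add: tail_norm_def case_prod_unfold)
    qed
    from commutator_tendsto_0[OF assms(1) params this]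
    show "((\<lambda>(a, b, r). Lp_norm p (op_A r a (op_B r b x) - op_B r b (op_A r a x))) \<longlongrightarrow> 0) F" .
  qed
qed

end
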